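(* Let $H$ be a $\{1,2\}$-graph on vertex set $[n]$, and suppose that the maximum order of a complete $\{1,2\}$-subgraph of $H$ is $t$, where $t\ge 2$. Then $$\lambda'(H)=\lambda'(K^{\{1,2\}}_t)=2-\frac{1}{t}.$$
   Context: A hypergraph $H=(V,E)$ has edges that are subsets of $V$; its set of edge types is $R(H)=\{|F|:F\in E\}$, and $H$ is called an $R(H)$-graph. For $j\in R(H)$, the level hypergraph $H^j$ consists of all edges of $H$ with exactly $j$ vertices. A $\{1,2\}$-graph is thus a hypergraph whose edges are exactly of sizes 1 and 2 (both types occurring). The complete hypergraph $K^R_m$ on $m$ vertices has edge set $\bigcup_{i\in R}\binom{[m]}{i}$; a complete $\{1,2\}$-subgraph of order $m$ of $H$ is a set of $m$ vertices such that every singleton and every pair from this set is an edge of $H$. For a hypergraph $H$ on $[n]$ and $\vec x=(x_1,\dots,x_n)$, define $$\lambda'(H,\vec x)=\sum_{j\in R(H)} j!\sum_{i_1i_2\cdots i_j\in E(H^j)} x_{i_1}x_{i_2}\cdots x_{i_j},$$ and the Lagrangian $\lambda'(H)=\max\{\lambda'(H,\vec x):\vec x\in S\}$ where $S=\{\vec x\in\mathbb R^n:\sum_i x_i=1,\ x_i\ge 0\}$. *)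

theory Defs
  imports Complex_Main "HOL-Library.FuncSet"
begin

definition hypergraph :: "'a set \<Rightarrow> 'a set set \<Rightarrow> bool" where
  "hypergraph V E \<longleftrightarrow> finite V \<and> (\<forall>F\<in>E. F \<subseteq> V)"

definition edge_types :: "'a set set \<Rightarrow> nat set" where
  "edge_types E = card ` E"

text \<open>All edge types in \<open>R\<close> must actually occur in \<open>E\<close>.\<close>

definition R_graph :: "nat set \<Rightarrow> 'a set \<Rightarrow> 'a set set \<Rightarrow> bool" where
  "R_graph R V E \<longleftrightarrow> hypergraph V E \<and> edge_types E = R"

definition level_edges :: "'a set set \<Rightarrow> nat \<Rightarrow> 'a set set" where
  "level_edges E j = {F \<in> E. card F = j}"

text \<open>The edge set of the complete hypergraph on the vertex set \<open>{1..m}\<close>.\<close>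

definition complete_edges :: "nat set \<Rightarrow> nat \<Rightarrow> nat set set" where
  "complete_edges R m = (\<Union>i\<in>R. {F. F \<subseteq> {1..m} \<and> card F = i})"

definition complete_subgraph_on :: "nat set \<Rightarrow> 'a set \<Rightarrow> 'a set set \<Rightarrow> 'a set \<Rightarrow> bool" where
  "complete_subgraph_on R V E U \<longleftrightarrow> U \<subseteq> V \<and> (\<forall>F. F \<subseteq> U \<and> card F \<in> R \<longrightarrow> F \<in> E)"

text \<open>For finite \<open>V\<close> and \<open>0 \<notin> R\<close> the maximum below is over a finite set that
  contains \<open>0\<close>, because \<open>U = {}\<close> qualifies.\<close>

definition max_complete_order :: "nat set \<Rightarrow> 'a set \<Rightarrow> 'a set set \<Rightarrow> nat" where
  "max_complete_order R V E = Max {card U | U. complete_subgraph_on R V E U}"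

text \<open>Vectors indexed by \<open>V\<close> are functions that are \<open>undefined\<close> outside \<open>V\<close>.\<close>

definition std_simplex :: "'a set \<Rightarrow> ('a \<Rightarrow> real) set" where
  "std_simplex V = {x \<in> V \<rightarrow>\<^sub>E UNIV. (\<Sum>i\<in>V. x i) = 1 \<and> (\<forall>i\<in>V. x i \<ge> 0)}"

definition lagrangian_poly :: "'a set set \<Rightarrow> ('a \<Rightarrow> real) \<Rightarrow> real" where
  "lagrangian_poly E x =
     (\<Sum>j\<in>edge_types E. fact j * (\<Sum>F\<in>level_edges E j. \<Prod>i\<in>F. x i))"

text \<open>\<open>GREATEST\<close> is a genuine maximum: its value is determined only if it is attained.\<close>

definition lagrangian :: "'a set \<Rightarrow> 'a set set \<Rightarrow> real" where
  "lagrangian V E = (GREATEST v. \<exists>x\<in>std_simplex V. v = lagrangian_poly E x)"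

end

theory Submission
  imports Defs "HOL-Analysis.Convex"
begin

text \<open>With \<open>L\<close> the set of vertices whose singleton is an edge and \<open>s\<close> the weight of \<open>L\<close>, the
  Motzkin-Straus inequality on \<open>L\<close> gives at most \<open>(1 - 1/t) s\<^sup>2\<close> for the pairs inside \<open>L\<close>, and the
  remaining pairs contribute at most \<open>1 - s\<^sup>2\<close>. Hence the Lagrangian polynomial is at most
  \<open>1 + s - s\<^sup>2/t\<close>, which is increasing on \<open>[0, 1]\<close> because \<open>t \<ge> 2\<close>, so it is at most \<open>2 - 1/t\<close>.
  The uniform distribution on a largest complete subgraph attains this value.\<close>

section \<open>Quadratic forms of graphs and the Motzkin-Straus inequality\<close>

text \<open>Summing over ordered pairs counts every edge twice, which absorbs the coefficient
  \<open>fact 2\<close> of the Lagrangian polynomial.\<close>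

definition adjacency_form :: "('a \<Rightarrow> 'a \<Rightarrow> bool) \<Rightarrow> 'a set \<Rightarrow> ('a \<Rightarrow> real) \<Rightarrow> real" where
  "adjacency_form A L x = (\<Sum>i\<in>L. \<Sum>j\<in>L. if A i j then x i * x j else 0)"

text \<open>By symmetry the row and the column of \<open>v\<close> contribute equally, and
  irreflexivity removes the diagonal term. So the form is affine in \<open>x v\<close>.\<close>

lemma adjacency_form_insert:
  assumes "finite L" "v \<notin> L" "symp A" "irreflp A"
  shows "adjacency_form A (insert v L) x
    = adjacency_form A L x + 2 * x v * (\<Sum>j\<in>L. if A v j then x j else 0)"
proof -
  have sym: "A i v \<longleftrightarrow> A v i" for i
    using assms(3) by (auto dest: sympD)
  have irr: "\<not> A v v"
    using assms(4) by (auto dest: irreflpD)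
  have "(\<Sum>i\<in>L. if A i v then x i * x v else 0) = x v * (\<Sum>j\<in>L. if A v j then x j else 0)"
    "(\<Sum>j\<in>L. if A v j then x v * x j else 0) = x v * (\<Sum>j\<in>L. if A v j then x j else 0)"
    unfolding sum_distrib_left by (intro sum.cong; use sym in auto)+
  then show ?thesis
    using assms(1,2) irr by (simp add: adjacency_form_def sum.distrib)
qed

lemma adjacency_form_cong:
  assumes "\<And>i. i \<in> L \<Longrightarrow> x i = y i"
  shows "adjacency_form A L x = adjacency_form A L y"
  unfolding adjacency_form_def using assms by (intro sum.cong) auto

text \<open>On a clique, the expansion of the squared sum differs from the form only by its
  diagonal.\<close>

lemma adjacency_form_clique:
  assumes "finite L" "irreflp A" "\<And>i j. i \<in> L \<Longrightarrow> j \<in> L \<Longrightarrow> i \<noteq> j \<Longrightarrow> A i j"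
  shows "adjacency_form A L x = (\<Sum>i\<in>L. x i)\<^sup>2 - (\<Sum>i\<in>L. (x i)\<^sup>2)"
proof -
  have "(\<Sum>j\<in>L. if A i j then x i * x j else 0) = x i * (\<Sum>j\<in>L. x j) - (x i)\<^sup>2" if "i \<in> L" for i
  proof -
    have "(\<Sum>j\<in>L. if A i j then x i * x j else 0)
        = (\<Sum>j\<in>L. x i * x j - (if j = i then x i * x j else 0))"
      using assms that by (intro sum.cong) (auto dest: irreflpD)
    also have "\<dots> = x i * (\<Sum>j\<in>L. x j) - (x i)\<^sup>2"
      using assms(1) that by (simp add: sum_subtractf sum_distrib_left power2_eq_square)
    finally show ?thesis .
  qed
  then show ?thesis
    by (simp add: adjacency_form_def sum_subtractf power2_eq_square flip: sum_distrib_right)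
qed

text \<open>If \<open>u\<close> and \<open>v\<close> are not adjacent, the form is affine along shifts of weight between them, so
  moving all weight to the one with the larger weighted degree does not decrease it.\<close>

theorem Motzkin_Straus:
  assumes "finite L" "symp A" "irreflp A"
    and "\<And>K. K \<subseteq> L \<Longrightarrow> (\<And>i j. i \<in> K \<Longrightarrow> j \<in> K \<Longrightarrow> i \<noteq> j \<Longrightarrow> A i j) \<Longrightarrow> card K \<le> t"
    and "\<And>i. i \<in> L \<Longrightarrow> x i \<ge> 0"
  shows "adjacency_form A L x \<le> (1 - 1 / real t) * (\<Sum>i\<in>L. x i)\<^sup>2"
  using assms(1,4,5)
\<comment> \<open>The weights are generalized as well, since the induction hypothesis is applied to
  shifted weights.\<close>
proof (induction "card L" arbitrary: L x rule: less_induct)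
  case less
  show ?case
  proof (cases "\<forall>i\<in>L. \<forall>j\<in>L. i \<noteq> j \<longrightarrow> A i j")
    case True
    show ?thesis
    \<comment> \<open>The clique case divides by \<open>card L\<close>, so the empty set is treated
      first.\<close>
    proof (cases "L = {}")
      case True
      then show ?thesis by (simp add: adjacency_form_def)
    next
      case False
      have "card L \<le> t" "card L > 0"
        using True False less.prems by (auto simp: card_gt_0_iff)
      then have "(\<Sum>i\<in>L. x i)\<^sup>2 / t \<le> (\<Sum>i\<in>L. x i)\<^sup>2 / card L"
        by (intro divide_left_mono) auto
      \<comment> \<open>This is Cauchy-Schwarz.\<close>
      also have "\<dots> \<le> (\<Sum>i\<in>L. (x i)\<^sup>2)"
        using sum_squared_le_sum_of_squares[of x L] \<open>card L > 0\<close>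
        by (simp add: divide_le_eq mult.commute)
      finally show ?thesis
        using True less.prems(1) assms(3) by (simp add: adjacency_form_clique algebra_simps)
    qed
  next
    case False
    define d where "d u M = (\<Sum>j\<in>M. if A u j then x j else 0)" for u M
    \<comment> \<open>Non-adjacency is symmetric, so the names can be chosen such that
      \<open>u\<close> has the larger weighted degree.\<close>
    obtain u v where uv: "u \<in> L" "v \<in> L" "u \<noteq> v" "\<not> A u v" "\<not> A v u"
      and deg: "d v (L - {u, v}) \<le> d u (L - {u, v})"
    proof -
      obtain u v where "u \<in> L" "v \<in> L" "u \<noteq> v" "\<not> A u v"
        using False by blast
      moreover from this have "\<not> A v u"
        using assms(2) by (auto dest: sympD)
      moreover have "L - {u, v} = L - {v, u}" by auto
      ultimately show ?thesis
        using that[of u v] that[of v u] by (metis linear)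
    qed
    define M where "M = L - {u, v}"
    \<comment> \<open>The weight of \<open>v\<close> moves to \<open>u\<close>. The value at
      \<open>v\<close> can stay, because \<open>v\<close> is deleted from the vertex set.\<close>
    define y where "y = x(u := x u + x v)"
    have M: "finite M" "u \<notin> M" "v \<notin> M" "L - {v} = insert u M" "L = insert v (insert u M)"
      using uv less.prems(1) by (auto simp: M_def)
    have yM: "y j = x j" if "j \<in> M" for j
      using that M(2) by (auto simp: y_def)
    have dy: "(\<Sum>j\<in>M. if A u j then y j else 0) = d u M"
      unfolding d_def using yM by (intro sum.cong) auto
    \<comment> \<open>There is no term in \<open>x u * x v\<close>, because \<open>u\<close> and
      \<open>v\<close> are not adjacent.\<close>
    have "adjacency_form A L x = adjacency_form A M x + 2 * x u * d u M + 2 * x v * d v M"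
      using M uv assms by (simp add: adjacency_form_insert d_def)
    also have "\<dots> \<le> adjacency_form A M x + 2 * x u * d u M + 2 * x v * d u M"
      using deg uv less.prems(3)[of v] by (auto simp: M_def intro!: mult_left_mono)
    also have "\<dots> = adjacency_form A M y + 2 * y u * (\<Sum>j\<in>M. if A u j then y j else 0)"
      unfolding dy by (simp add: adjacency_form_cong[OF yM] algebra_simps) (simp add: y_def algebra_simps)
    also have "\<dots> = adjacency_form A (L - {v}) y"
      unfolding M(4) using M assms by (simp add: adjacency_form_insert)
    also have "\<dots> \<le> (1 - 1 / real t) * (\<Sum>i\<in>L - {v}. y i)\<^sup>2"
    proof (rule less.hyps)
      show "card (L - {v}) < card L"
        using uv less.prems(1) by (intro card_Diff1_less)
      show "card K \<le> t" if "K \<subseteq> L - {v}" "\<And>i j. i \<in> K \<Longrightarrow> j \<in> K \<Longrightarrow> i \<noteq> j \<Longrightarrow> A i j" for K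
        using that by (intro less.prems(2)) auto
      show "y i \<ge> 0" if "i \<in> L - {v}" for i
        using that less.prems(3) uv by (auto simp: y_def)
    qed (use less.prems(1) in auto)
    also have "(\<Sum>i\<in>L - {v}. y i) = (\<Sum>i\<in>L. x i)"
    proof -
      have "(\<Sum>i\<in>M. y i) = (\<Sum>i\<in>M. x i)" using yM by simp
      then show ?thesis
        unfolding M(4) using M(1-3,5) uv(3) by (simp add: y_def)
    qed
    finally show ?thesis .
  qed
qed

section \<open>The Lagrangian polynomial as a linear part plus a quadratic form\<close>

abbreviation adj :: "'a set set \<Rightarrow> 'a \<Rightarrow> 'a \<Rightarrow> bool" where
  "adj E \<equiv> \<lambda>i j. i \<noteq> j \<and> {i, j} \<in> E"

lemma symp_adj: "symp (adj E)" and irreflp_adj: "irreflp (adj E)"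
  by (auto intro!: sympI irreflpI simp: insert_commute)

lemma sum_level_edges_1:
  fixes x :: "'a \<Rightarrow> real"
  assumes "hypergraph V E"
  shows "(\<Sum>F\<in>level_edges E 1. \<Prod>i\<in>F. x i) = (\<Sum>i | i \<in> V \<and> {i} \<in> E. x i)"
proof -
  have "level_edges E 1 = (\<lambda>i. {i}) ` {i \<in> V. {i} \<in> E}"
    using assms by (auto simp: level_edges_def hypergraph_def card_1_singleton_iff)
  then show ?thesis
    by (simp add: sum.reindex inj_on_def)
qed

text \<open>Each edge with two vertices comes from exactly two ordered pairs, and both carry the
  same product of weights.\<close>

lemma sum_level_edges_2:
  assumes "hypergraph V E"
  shows "2 * (\<Sum>F\<in>level_edges E 2. \<Prod>i\<in>F. x i) = adjacency_form (adj E) V x"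
proof -
  define P where "P = {(i, j). i \<in> V \<and> j \<in> V \<and> adj E i j}"
  have V: "finite V" using assms by (simp add: hypergraph_def)
  have finP: "finite P"
    by (rule finite_subset[of _ "V \<times> V"]) (use V in \<open>auto simp: P_def\<close>)
  have im: "(\<lambda>(i, j). {i, j}) ` P = level_edges E 2"
  proof (intro equalityI subsetI)
    fix F assume "F \<in> level_edges E 2"
    then have F: "F \<in> E" "card F = 2" by (auto simp: level_edges_def)
    then obtain i j where ij: "F = {i, j}" "i \<noteq> j" by (auto simp: card_2_iff)
    have "F \<subseteq> V" using F assms by (auto simp: hypergraph_def)
    then show "F \<in> (\<lambda>(i, j). {i, j}) ` P"
      using F ij by (intro image_eqI[of _ _ "(i, j)"]) (auto simp: P_def)
  qed (auto simp: P_def level_edges_def)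
  have "adjacency_form (adj E) V x = (\<Sum>p\<in>V \<times> V. if p \<in> P then x (fst p) * x (snd p) else 0)"
    unfolding adjacency_form_def sum.cartesian_product
    by (intro sum.cong) (auto simp: P_def split: if_splits)
  also have "\<dots> = (\<Sum>p\<in>P. x (fst p) * x (snd p))"
    using V by (intro sum.mono_neutral_cong_right) (auto simp: P_def split: if_splits)
  \<comment> \<open>The ordered pairs are grouped by their underlying edge.\<close>
  also have "\<dots> = (\<Sum>F\<in>level_edges E 2.
      \<Sum>p | p \<in> P \<and> (\<lambda>(i, j). {i, j}) p = F. x (fst p) * x (snd p))"
    using sum.image_gen[OF finP, of _ "\<lambda>(i, j). {i, j}"] im by simp
  also have "\<dots> = (\<Sum>F\<in>level_edges E 2. 2 * (\<Prod>i\<in>F. x i))"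
  proof (rule sum.cong[OF refl])
    fix F assume "F \<in> level_edges E 2"
    then obtain i j where ij: "(i, j) \<in> P" "F = {i, j}"
      unfolding im[symmetric] by auto
    then have "(j, i) \<in> P" "i \<noteq> j"
      by (auto simp: P_def insert_commute)
    moreover have "{p. p \<in> P \<and> (\<lambda>(i, j). {i, j}) p = F} = {(i, j), (j, i)}"
    proof (intro equalityI subsetI)
      fix p assume "p \<in> {p. p \<in> P \<and> (\<lambda>(i, j). {i, j}) p = F}"
      then have "{fst p, snd p} = {i, j}"
        using ij(2) by (simp add: case_prod_beta)
      then show "p \<in> {(i, j), (j, i)}"
        by (cases p) (simp add: doubleton_eq_iff)
    qed (use ij \<open>(j, i) \<in> P\<close> in auto)
    ultimately show "(\<Sum>p | p \<in> P \<and> (\<lambda>(i, j). {i, j}) p = F. x (fst p) * x (snd p)) = 2 * (\<Prod>i\<in>F. x i)"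
      using ij(2) by simp
  qed
  finally show ?thesis by (simp add: sum_distrib_left)
qed

lemma lagrangian_poly_12:
  assumes "R_graph {1, 2} V E"
  shows "lagrangian_poly E x = (\<Sum>i | i \<in> V \<and> {i} \<in> E. x i) + adjacency_form (adj E) V x"
  using assms sum_level_edges_1[of V E x] sum_level_edges_2[of V E x]
  by (simp add: lagrangian_poly_def R_graph_def del: One_nat_def)

section \<open>The upper bound\<close>

text \<open>Pairs in \<open>V \<times> V\<close> but not in \<open>L \<times> L\<close> are counted
  in full, adjacent or not. Their total weight is the difference of the two squares.\<close>

lemma adjacency_form_subset_le:
  assumes "finite V" "L \<subseteq> V" "\<And>i. i \<in> V \<Longrightarrow> x i \<ge> 0"
  shows "adjacency_form A V x \<le> adjacency_form A L x + (\<Sum>i\<in>V. x i)\<^sup>2 - (\<Sum>i\<in>L. x i)\<^sup>2"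
proof -
  have sq: "(\<Sum>i\<in>K. x i)\<^sup>2 = (\<Sum>p\<in>K \<times> K. x (fst p) * x (snd p))" for K
    by (simp add: power2_eq_square sum_product sum.cartesian_product case_prod_beta)
  have form: "adjacency_form A K x
      = (\<Sum>p\<in>K \<times> K. if A (fst p) (snd p) then x (fst p) * x (snd p) else 0)" for K
    by (simp add: adjacency_form_def sum.cartesian_product case_prod_beta)
  have sub: "L \<times> L \<subseteq> V \<times> V" and fin: "finite (V \<times> V)"
    using assms by auto
  have "adjacency_form A V x - adjacency_form A L x
      = (\<Sum>p\<in>V \<times> V - L \<times> L. if A (fst p) (snd p) then x (fst p) * x (snd p) else 0)"
    unfolding form by (rule sum_diff[OF fin sub, symmetric])
  also have "\<dots> \<le> (\<Sum>p\<in>V \<times> V - L \<times> L. x (fst p) * x (snd p))"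
    using assms(3) by (intro sum_mono) auto
  also have "\<dots> = (\<Sum>i\<in>V. x i)\<^sup>2 - (\<Sum>i\<in>L. x i)\<^sup>2"
    unfolding sq by (rule sum_diff[OF fin sub])
  finally show ?thesis by simp
qed

text \<open>This identifies the complete subgraphs with the cliques of \<open>adj E\<close> among
  the vertices whose singletons are edges, the form in which Motzkin-Straus applies.\<close>

lemma complete_subgraph_on_12_iff:
  "complete_subgraph_on {1, 2} V E U \<longleftrightarrow>
    U \<subseteq> V \<and> (\<forall>i\<in>U. {i} \<in> E) \<and> (\<forall>i\<in>U. \<forall>j\<in>U. i \<noteq> j \<longrightarrow> adj E i j)"
proof -
  have "(\<forall>F. F \<subseteq> U \<and> card F \<in> {1, 2} \<longrightarrow> F \<in> E)
      \<longleftrightarrow> (\<forall>F. F \<subseteq> U \<and> is_singleton F \<longrightarrow> F \<in> E) \<and> (\<forall>F. F \<subseteq> U \<and> card F = 2 \<longrightarrow> F \<in> E)"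
    unfolding is_singleton_altdef by blast
  moreover have "(\<forall>F. F \<subseteq> U \<and> is_singleton F \<longrightarrow> F \<in> E) \<longleftrightarrow> (\<forall>i\<in>U. {i} \<in> E)"
    unfolding is_singleton_def by blast
  moreover have "(\<forall>F. F \<subseteq> U \<and> card F = 2 \<longrightarrow> F \<in> E) \<longleftrightarrow> (\<forall>i\<in>U. \<forall>j\<in>U. i \<noteq> j \<longrightarrow> adj E i j)"
  proof (intro iffI ballI impI allI)
    fix i j assume "\<forall>F. F \<subseteq> U \<and> card F = 2 \<longrightarrow> F \<in> E" "i \<in> U" "j \<in> U" "i \<noteq> j"
    then show "adj E i j" by (metis card_2_iff empty_subsetI insert_subset)
  next
    fix F assume "\<forall>i\<in>U. \<forall>j\<in>U. i \<noteq> j \<longrightarrow> adj E i j" "F \<subseteq> U \<and> card F = 2"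
    then show "F \<in> E" by (metis card_2_iff insert_subset)
  qed
  ultimately show ?thesis
    unfolding complete_subgraph_on_def by (simp only:)
qed

lemma finite_complete_orders:
  assumes "finite V"
  shows "finite {card U | U. complete_subgraph_on R V E U}"
  by (rule finite_subset[of _ "card ` Pow V"]) (use assms in \<open>auto simp: complete_subgraph_on_def\<close>)

lemma lagrangian_poly_12_le:
  assumes "R_graph {1, 2} V E" "x \<in> std_simplex V" "t \<ge> 2"
    and cliques: "\<And>U. complete_subgraph_on {1, 2} V E U \<Longrightarrow> card U \<le> t"
  shows "lagrangian_poly E x \<le> 2 - 1 / real t"
proof -
  have V: "finite V" using assms(1) by (simp add: R_graph_def hypergraph_def)
  have x: "(\<Sum>i\<in>V. x i) = 1" "\<And>i. i \<in> V \<Longrightarrow> x i \<ge> 0"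
    using assms(2) by (auto simp: std_simplex_def)
  define L where "L = {i \<in> V. {i} \<in> E}"
  define s where "s = (\<Sum>i\<in>L. x i)"
  have L: "L \<subseteq> V" by (auto simp: L_def)
  have s: "0 \<le> s" "s \<le> 1"
    using x(2) L sum_mono2[OF V L, of x] unfolding s_def x(1)[symmetric]
    by (auto intro!: sum_nonneg)
  have MS: "adjacency_form (adj E) L x \<le> (1 - 1 / real t) * s\<^sup>2"
    unfolding s_def
  proof (rule Motzkin_Straus[OF _ symp_adj irreflp_adj])
    show "card K \<le> t" if "K \<subseteq> L" "\<And>i j. i \<in> K \<Longrightarrow> j \<in> K \<Longrightarrow> i \<noteq> j \<Longrightarrow> adj E i j" for K
      using that by (intro cliques) (unfold complete_subgraph_on_12_iff, auto simp: L_def)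
  qed (use V L x(2) finite_subset in auto)
  have "lagrangian_poly E x \<le> 1 + s - s\<^sup>2 / t"
    using MS adjacency_form_subset_le[where A = "adj E" and x = x, OF V L x(2)] x(1)
    unfolding lagrangian_poly_12[OF assms(1)] L_def[symmetric] s_def[symmetric]
    by (simp add: algebra_simps)
  also have "\<dots> \<le> 2 - 1 / real t"
  proof -
    \<comment> \<open>Here 2 \<le> t enters, through 1 + s \<le> 2. Dividing by \<open>t\<close>
      gives the monotonicity claim in the form needed, by comparison with the value at s =
      1.\<close>
    have "(1 - s) * (1 + s) \<le> (1 - s) * real t"
      using s assms(3) by (intro mult_left_mono) auto
    then have "(1 - s) * (1 + s) / t \<le> 1 - s"
      using assms(3) by (simp add: divide_le_eq)
    moreover have "(1 - s) * (1 + s) / t = 1 / t - s\<^sup>2 / t"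
      by (simp add: algebra_simps power2_eq_square diff_divide_distrib)
    ultimately show ?thesis by simp
  qed
  finally show ?thesis .
qed

section \<open>Attainment and the value of the Lagrangian\<close>

text \<open>All the weight lies on vertices whose singletons are edges, so the linear part is 1, and
  the clique formula gives the rest. The restriction to \<open>V\<close> in \<open>x\<close>
  provides the value \<open>undefined\<close> outside \<open>V\<close> that
  \<open>std_simplex\<close> demands.\<close>

lemma lagrangian_poly_12_uniform:
  assumes "R_graph {1, 2} V E" "complete_subgraph_on {1, 2} V E U" "U \<noteq> {}"
  defines "x \<equiv> \<lambda>i\<in>V. if i \<in> U then 1 / real (card U) else 0"
  shows "x \<in> std_simplex V" "lagrangian_poly E x = 2 - 1 / real (card U)"
proof -
  have V: "finite V" using assms(1) by (simp add: R_graph_def hypergraph_def)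
  have U: "U \<subseteq> V" "\<And>i. i \<in> U \<Longrightarrow> {i} \<in> E" "\<And>i j. i \<in> U \<Longrightarrow> j \<in> U \<Longrightarrow> i \<noteq> j \<Longrightarrow> adj E i j"
    using assms(2) unfolding complete_subgraph_on_12_iff by blast+
  have finU: "finite U" using U(1) V by (rule finite_subset)
  then have cU: "card U > 0" using assms(3) by (simp add: card_gt_0_iff)
  have xU: "x i = 1 / real (card U)" if "i \<in> U" for i
    using that U(1) by (auto simp: x_def)
  have x0: "x i = 0" if "i \<in> V - U" for i
    using that by (auto simp: x_def)
  have sumU: "(\<Sum>i\<in>K. x i) = 1" if "U \<subseteq> K" "K \<subseteq> V" for K
  proof -
    have "(\<Sum>i\<in>K. x i) = (\<Sum>i\<in>U. x i)"
      using that V x0 by (intro sum.mono_neutral_right) (auto intro: finite_subset)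
    then show ?thesis using xU cU by simp
  qed
  show "x \<in> std_simplex V"
    using sumU[of V] U(1) by (auto simp: std_simplex_def x_def)
  \<comment> \<open>A pair not contained in \<open>U\<close> has a factor of weight 0.\<close>
  have "adjacency_form (adj E) V x = adjacency_form (adj E) U x"
    unfolding adjacency_form_def sum.cartesian_product
    using V U(1) x0 by (intro sum.mono_neutral_right) (fastforce split: if_splits)+
  also have "\<dots> = (\<Sum>i\<in>U. x i)\<^sup>2 - (\<Sum>i\<in>U. (x i)\<^sup>2)"
    by (rule adjacency_form_clique[OF finU irreflp_adj U(3)])
  also have "\<dots> = 1 - 1 / real (card U)"
    using sumU[of U] U(1) xU cU by (simp add: power2_eq_square)
  finally show "lagrangian_poly E x = 2 - 1 / real (card U)"
    using sumU[of "{i \<in> V. {i} \<in> E}"] U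
    by (simp add: lagrangian_poly_12[OF assms(1)] subset_iff)
qed

theorem lagrangian_12:
  assumes "R_graph {1, 2} V E" "max_complete_order {1, 2} V E = t" "t \<ge> 2"
  shows "lagrangian V E = 2 - 1 / real t"
  unfolding lagrangian_def
proof (rule Greatest_equality)
  let ?S = "{card U | U. complete_subgraph_on {1, 2} V E U}"
  have fin: "finite ?S"
    using assms(1) by (intro finite_complete_orders) (simp add: R_graph_def hypergraph_def)
  \<comment> \<open>The set of orders is therefore nonempty, so its maximum \<open>t\<close> is
    attained by some \<open>U\<close>.\<close>
  have "complete_subgraph_on {1, 2} V E {}"
    unfolding complete_subgraph_on_12_iff by simp
  then have "t \<in> ?S"
    using assms(2) Max_in[OF fin] unfolding max_complete_order_def by blast
  then obtain U where "complete_subgraph_on {1, 2} V E U" "card U = t" "U \<noteq> {}"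
    using assms(3) by force
  then show "\<exists>x\<in>std_simplex V. 2 - 1 / real t = lagrangian_poly E x"
    using lagrangian_poly_12_uniform[OF assms(1), of U] by metis
  have "card U \<le> t" if "complete_subgraph_on {1, 2} V E U" for U
    using that assms(2) Max_ge[OF fin] unfolding max_complete_order_def by blast
  then show "v \<le> 2 - 1 / real t" if "\<exists>x\<in>std_simplex V. v = lagrangian_poly E x" for v
    using that lagrangian_poly_12_le[OF assms(1) _ assms(3)] by blast
qed

section \<open>Complete hypergraphs\<close>

text \<open>The bound on \<open>R\<close> ensures that each type actually occurs, with
  \<open>{1..r}\<close> as an edge of size \<open>r\<close>.\<close>

lemma R_graph_complete_edges:
  assumes "\<And>r. r \<in> R \<Longrightarrow> r \<le> m"
  shows "R_graph R {1..m} (complete_edges R m)"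
proof -
  have "r \<in> card ` complete_edges R m" if "r \<in> R" for r
    using that assms[OF that]
    by (intro image_eqI[of _ _ "{1..r}"]) (auto simp: complete_edges_def)
  then show ?thesis
    by (auto simp: R_graph_def hypergraph_def edge_types_def complete_edges_def)
qed

lemma max_complete_order_complete_edges:
  "max_complete_order R {1..m} (complete_edges R m) = m"
  unfolding max_complete_order_def
proof (rule Max_eqI)
  show "finite {card U | U. complete_subgraph_on R {1..m} (complete_edges R m) U}"
    by (rule finite_complete_orders) simp
  show "k \<le> m" if "k \<in> {card U | U. complete_subgraph_on R {1..m} (complete_edges R m) U}" for k
    using that card_mono[of "{1..m}"] by (fastforce simp: complete_subgraph_on_def)
  have "complete_subgraph_on R {1..m} (complete_edges R m) {1..m}"
    by (auto simp: complete_subgraph_on_def complete_edges_def)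
  then show "m \<in> {card U | U. complete_subgraph_on R {1..m} (complete_edges R m) U}"
    by (intro CollectI exI[of _ "{1..m}"]) simp
qed

theorem theorem1p2:
  fixes n t :: nat and E :: "nat set set"
  assumes "R_graph {1, 2} {1..n} E"
    and "max_complete_order {1, 2} {1..n} E = t"
    and "t \<ge> 2"
  shows "lagrangian {1..n} E = lagrangian {1..t} (complete_edges {1, 2} t)
    \<and> lagrangian {1..t} (complete_edges {1, 2} t) = 2 - 1 / real t"
proof -
  have "R_graph {1, 2} {1..t} (complete_edges {1, 2} t)"
    using assms(3) by (intro R_graph_complete_edges) auto
  then show ?thesis
    \<comment> \<open>The value depends only on the maximum complete order, and the complete
      hypergraph has the same order \<open>t\<close>.\<close>
    using lagrangian_12[OF assms] lagrangian_12[OF _ max_complete_order_complete_edges assms(3)]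
    by simp
qed

end
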